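(* Let $F(z,x)$ be as defined in the context. For $z\in\mathbb{C}\setminus\{-1,-2,\dots\}$ and $0<x\le 1$, $$F(z,x)=\psi(z+1)+\gamma+\log x+\sum_{n=1}^{\infty}\frac{(1-x)^{z+n}}{z+n}=\psi(z+1)+\gamma+\log x+(1-x)^{z+1}\Phi(1-x,1,z+1).$$ For $-1<x<0$ and $z\in\mathbb{C}$ not a nonnegative integer, $$F(z,x)=\psi(1-z)+\gamma+\log(-x)+\frac{1-(1-x)^z}{z}+(1-x)^{z-1}\Phi\!\left(\frac{1}{1-x},1,1-z\right).$$
   Context: For $z\in\mathbb{C}$ and $|x|<1$, $F(z,x)=\sum_{n=1}^{\infty}\binom{z}{n}\frac{(-1)^{n-1}x^n}{n}$, with $\binom{z}{n}=\frac{z(z-1)\cdots(z-n+1)}{n!}$. For $x=1$: $F(z,1)$ is given by this series when $\operatorname{Re}z>-1$ (where it converges) and equals $\psi(z+1)+\gamma$ there; for other $z\notin\{-1,-2,\dots\}$, $F(z,1)$ is defined by the analytic continuation $F(z,1)=\psi(z+1)+\gamma$. Here $\psi=\Gamma'/\Gamma$ is the digamma function and $\gamma$ Euler's constant. The Lerch transcendent with $s=1$ is $\Phi(t,1,a)=\sum_{n=0}^{\infty}\frac{t^n}{n+a}$ for $|t|<1$, $a\notin\{0,-1,-2,\dots\}$. Powers of positive reals use the real logarithm. *)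

theory Defs
  imports "HOL-Analysis.Analysis"
begin

text \<open>
  The case distinction is the extension of \<open>z \<mapsto> F z 1\<close> by analytic continuation: at \<open>x = 1\<close> the
  series is used on the half-plane \<open>Re z > -1\<close> where it converges, and the continuation
  \<open>\<psi>(z+1) + \<gamma>\<close> elsewhere. Series over \<open>n \<ge> 1\<close> are indexed by \<open>Suc n\<close>, so the sign
  \<open>(-1)^(n-1)\<close> becomes \<open>(-1)^n\<close>. Values are meaningful only for \<open>norm x < 1\<close>, or for \<open>x = 1\<close>
  and \<open>z \<notin> {-1, -2, \<dots>}\<close>.
\<close>

definition F :: "complex \<Rightarrow> complex \<Rightarrow> complex" where
  "F z x =
     (if x = 1 \<and> Re z \<le> -1 then Digamma (z + 1) + euler_mascheroni
      else (\<Sum>n. (z gchoose Suc n) * (-1) ^ n * x ^ Suc n / of_nat (Suc n)))"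

text \<open>
  \<open>\<Phi>(t, 1, a)\<close>, meaningful for \<open>norm t < 1\<close> and \<open>a \<notin> {0, -1, -2, \<dots>}\<close>.
\<close>

definition Lerch_Phi_1 :: "complex \<Rightarrow> complex \<Rightarrow> complex" where
  "Lerch_Phi_1 t a = (\<Sum>n. t ^ n / (of_nat n + a))"

end

theory Submission
  imports Defs "HOL-Real_Asymp.Real_Asymp"
begin

text \<open>
  For \<open>0 < x < 1\<close> both sides of the first formula have the \<open>x\<close>-derivative \<open>(1 - (1 - x)^z) / x\<close>,
  so they differ by a constant. It is found by letting \<open>x\<close> tend to 0: there
  \<open>\<Phi>(1 - x, 1, z + 1) + log x\<close> turns into the series
  \<open>\<Sum> (1/(n + z + 1) - 1/(n + 1)) = - \<psi>(z + 1) - \<gamma>\<close>. The case \<open>x = 1\<close> follows by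
  continuity, since for \<open>Re z > -1\<close> the coefficients of \<open>F\<close> are absolutely summable.
  The second formula is the first one at \<open>-z\<close> and \<open>x / (x - 1)\<close>, combined with the Landen-type identity
  \<open>F(z, x) = F(-z, x/(x - 1)) + log(1 - x) + (1 - (1 - x)^z) / z\<close>.
\<close>

section \<open>Power series with absolutely summable coefficients, up to the boundary\<close>

text \<open>The norms of the coefficients serve as majorants in the Weierstrass M-test, so the
  partial sums converge uniformly on the closed disc.\<close>

lemma powser_continuous_on_cball:
  fixes c :: "nat \<Rightarrow> complex"
  assumes "summable (\<lambda>n. norm (c n))"
  shows "continuous_on (cball 0 1) (\<lambda>t. \<Sum>n. c n * t ^ n)"
proof (rule uniform_limit_theorem)
  show "uniform_limit (cball 0 1) (\<lambda>n t. \<Sum>i<n. c i * t ^ i) (\<lambda>t. \<Sum>n. c n * t ^ n) sequentially"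
    by (rule Weierstrass_m_test[OF _ assms])
       (auto simp: norm_mult norm_power intro!: mult_left_le power_le_one)
qed (auto intro!: always_eventually continuous_intros)

text \<open>Provides the passage to the endpoint 1 twice: for the series of \<open>F\<close> itself
  and for the Digamma series. Absolute summability does here what Abel's theorem would do under mere
  convergence.\<close>

lemma powser_tendsto_at_left_1:
  fixes c :: "nat \<Rightarrow> complex"
  assumes "summable (\<lambda>n. norm (c n))"
  shows "((\<lambda>x. \<Sum>n. c n * of_real x ^ n) \<longlongrightarrow> (\<Sum>n. c n)) (at_left (1::real))"
proof -
  have "continuous_on {-1..1} (\<lambda>x. \<Sum>n. c n * of_real x ^ n)"
    by (rule continuous_on_compose2[OF powser_continuous_on_cball[OF assms], of _ of_real])
       (auto intro!: continuous_intros)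
  hence "((\<lambda>x. \<Sum>n. c n * of_real x ^ n) \<longlongrightarrow> (\<Sum>n. c n * of_real 1 ^ n)) (at 1 within {-1..1::real})"
    unfolding continuous_on_def by (elim ballE[of _ _ 1]) auto
  thus ?thesis
    by (simp add: at_within_Icc_at_left)
qed

section \<open>The Lerch transcendent as a power series in \<open>t\<close>\<close>

text \<open>The coefficients tend to 0 and are therefore bounded, which allows comparison with a
  geometric series.\<close>

lemma summable_inverse_shift_powser:
  fixes a t :: complex
  assumes "norm t < 1"
  shows "summable (\<lambda>n. inverse (of_nat n + a) * t ^ n)"
proof -
  have "(\<lambda>n. inverse (of_nat n + a)) \<longlonglongrightarrow> 0"
    by (intro filterlim_compose[OF tendsto_inverse_0]
          tendsto_add_filterlim_at_infinity'[OF tendsto_of_nat tendsto_const])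
  then obtain C where C: "\<And>n. norm (inverse (of_nat n + a)) \<le> C"
    by (metis BseqE convergentI convergent_imp_Bseq)
  show ?thesis
  proof (rule summable_comparison_test')
    show "summable (\<lambda>n. C * norm t ^ n)"
      using assms by (intro summable_mult summable_geometric) auto
    show "norm (inverse (of_nat n + a) * t ^ n) \<le> C * norm t ^ n" if "n \<ge> 0" for n
      unfolding norm_mult norm_power by (intro mult_right_mono C) auto
  qed
qed

lemma Lerch_Phi_1_altdef: "Lerch_Phi_1 t a = (\<Sum>n. inverse (of_nat n + a) * t ^ n)"
  by (simp add: Lerch_Phi_1_def field_simps)

lemma isCont_Lerch_Phi_1: "norm t < 1 \<Longrightarrow> isCont (\<lambda>t. Lerch_Phi_1 t a) t"
  unfolding Lerch_Phi_1_altdef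
  by (intro DERIV_isCont[OF termdiffs_strong'[where K = 1]] summable_inverse_shift_powser) auto

text \<open>Formally the function is the sum of \<open>t powr (n + a) / (n + a)\<close>, and
  differentiating each term leaves \<open>t powr (a - 1)\<close> times the geometric series. The
  proof applies the product rule instead, so that only a genuine power series is differentiated
  termwise.\<close>

lemma has_field_derivative_powr_Lerch_Phi_1:
  assumes t: "norm t < 1" "t \<notin> \<real>\<^sub>\<le>\<^sub>0" and a: "a \<notin> \<int>\<^sub>\<le>\<^sub>0"
  shows "((\<lambda>t. t powr a * Lerch_Phi_1 t a) has_field_derivative t powr (a - 1) / (1 - t)) (at t)"
proof -
  define c where "c n = inverse (of_nat n + a)" for n
  have summable: "summable (\<lambda>n. c n * t ^ n)" if "norm t < 1" for t
    unfolding c_def by (rule summable_inverse_shift_powser[OF that])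
  define D where "D = (\<Sum>n. diffs c n * t ^ n)"
  have D: "((\<lambda>t. Lerch_Phi_1 t a) has_field_derivative D) (at t)"
    unfolding Lerch_Phi_1_altdef D_def c_def[symmetric]
    using summable t by (intro termdiffs_strong'[where K = 1]) auto
  have nz: "of_nat n + a \<noteq> 0" for n
    using a using plus_of_nat_eq_0_imp[of a n] by (auto simp: add.commute)
  \<comment> \<open>The operator \<open>a + t * d/dt\<close> multiplies the coefficient
    \<open>c n\<close> by \<open>of_nat n + a\<close>, which turns every coefficient into 1.\<close>
  have "(\<lambda>n. a * (c n * t ^ n) + of_nat n * c n * t ^ n) sums (a * Lerch_Phi_1 t a + t * D)"
  proof (intro sums_add sums_mult)
    show "(\<lambda>n. c n * t ^ n) sums Lerch_Phi_1 t a"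
      unfolding Lerch_Phi_1_altdef c_def[symmetric] using summable t by (auto intro: summable_sums)
    have "(\<lambda>n. diffs c n * t ^ n) sums D"
      unfolding D_def by (intro summable_sums termdiff_converges[where K = 1] summable) (use t in auto)
    hence "(\<lambda>n. t * (diffs c n * t ^ n)) sums (t * D)"
      by (rule sums_mult)
    also have "(\<lambda>n. t * (diffs c n * t ^ n)) = (\<lambda>n. of_nat (Suc n) * c (Suc n) * t ^ Suc n)"
      by (simp add: diffs_def mult_ac del: of_nat_Suc)
    finally show "(\<lambda>n. of_nat n * c n * t ^ n) sums (t * D)"
      by (subst (asm) sums_Suc_iff) auto
  qed
  also have "(\<lambda>n. a * (c n * t ^ n) + of_nat n * c n * t ^ n) = (\<lambda>n. t ^ n)"
  proof
    fix n
    have "a * (c n * t ^ n) + of_nat n * c n * t ^ n = (of_nat n + a) * c n * t ^ n"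
      by (simp add: algebra_simps)
    thus "a * (c n * t ^ n) + of_nat n * c n * t ^ n = t ^ n"
      using nz[of n] by (simp add: c_def)
  qed
  finally have eq: "a * Lerch_Phi_1 t a + t * D = 1 / (1 - t)"
    using geometric_sums[OF t(1)] sums_unique2 by blast
  have "t \<noteq> 0"
    using t by auto
  have pw: "t powr a = t powr (a - 1) * t"
    using \<open>t \<noteq> 0\<close> by (simp add: powr_diff)
  have "((\<lambda>t. t powr a * Lerch_Phi_1 t a) has_field_derivative
          a * t powr (a - 1) * Lerch_Phi_1 t a + D * t powr a) (at t)"
    by (intro DERIV_mult D has_field_derivative_powr t)
  also have "a * t powr (a - 1) * Lerch_Phi_1 t a + D * t powr a =
             t powr (a - 1) * (a * Lerch_Phi_1 t a + t * D)"
    unfolding pw by (simp add: algebra_simps)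
  finally show ?thesis
    by (simp add: eq)
qed

section \<open>The power series of \<open>F\<close> in its second argument\<close>

text \<open>At \<open>n = 0\<close> the division by zero yields the constant coefficient 0 of \<open>F\<close>.\<close>

definition F_coeff :: "complex \<Rightarrow> nat \<Rightarrow> complex" where
  "F_coeff z n = - (z gchoose n) * (-1) ^ n / of_nat n"

lemma F_coeff_0 [simp]: "F_coeff z 0 = 0"
  by (simp add: F_coeff_def)

lemma sums_binomial_minus:
  fixes z t :: complex
  assumes "norm t < 1"
  shows "(\<lambda>n. (z gchoose n) * (-1) ^ n * t ^ n) sums (1 - t) powr z"
  using gen_binomial_complex[of "-t" z] assms by (simp add: power_minus' mult_ac power_minus[of t])

lemma summable_F_coeff:
  assumes "norm t < 1"
  shows "summable (\<lambda>n. F_coeff z n * t ^ n)"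
proof -
  \<comment> \<open>Any point strictly between \<open>norm t\<close> and 1 would do: convergence of
    the binomial series at \<open>r\<close> gives absolute convergence at \<open>t\<close>, and
    dividing by \<open>n\<close> only shrinks the terms.\<close>
  define r where "r = (1 + norm t) / 2"
  have r: "norm t < r" "r < 1" "0 \<le> r"
    using assms by (auto simp: r_def)
  have "summable (\<lambda>n. (z gchoose n) * (-1) ^ n * of_real r ^ n)"
    using sums_binomial_minus[of "of_real r" z] r by (auto simp: sums_iff)
  hence "summable (\<lambda>n. norm ((z gchoose n) * (-1) ^ n * t ^ n))"
    by (rule powser_insidea) (use r in auto)
  thus ?thesis
  proof (rule summable_comparison_test')
    fix n :: nat assume "n \<ge> 0"
    have "norm (z gchoose n) * norm t ^ n / real n \<le> norm (z gchoose n) * norm t ^ n / 1" if "n > 0"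
      by (rule divide_left_mono) (use that in auto)
    thus "norm (F_coeff z n * t ^ n) \<le> norm ((z gchoose n) * (-1) ^ n * t ^ n)"
      by (cases "n = 0") (auto simp: F_coeff_def norm_mult norm_divide norm_power)
  qed
qed

text \<open>The second assumption keeps \<open>F\<close> in its series branch at
  \<open>t = 1\<close>; starting the sum at 0 is harmless because
  \<open>F_coeff z 0 = 0\<close>.\<close>

lemma F_eq_powser:
  assumes "summable (\<lambda>n. F_coeff z n * t ^ n)" "t = 1 \<Longrightarrow> Re z > -1"
  shows "F z t = (\<Sum>n. F_coeff z n * t ^ n)"
proof -
  have "(\<Sum>n. F_coeff z n * t ^ n) = (\<Sum>n. F_coeff z (Suc n) * t ^ Suc n)"
    using suminf_split_head[OF assms(1)] by simp
  thus ?thesis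
    using assms(2) by (auto simp: F_def F_coeff_def)
qed

lemma F_0 [simp]: "F z 0 = 0"
  by (simp add: F_def)

lemma has_field_derivative_F_diffs:
  assumes "norm t < 1"
  shows "(F z has_field_derivative (\<Sum>n. diffs (F_coeff z) n * t ^ n)) (at t)"
proof -
  have "((\<lambda>t. \<Sum>n. F_coeff z n * t ^ n) has_field_derivative
          (\<Sum>n. diffs (F_coeff z) n * t ^ n)) (at t)"
    by (intro termdiffs_strong'[where K = 1] summable_F_coeff assms)
  moreover have "eventually (\<lambda>t. F z t = (\<Sum>n. F_coeff z n * t ^ n)) (nhds t)"
  proof -
    have "eventually (\<lambda>t. t \<in> ball 0 1) (nhds t)"
      using assms by (intro eventually_nhds_in_open) auto
    thus ?thesis
      by eventually_elim (intro F_eq_powser summable_F_coeff, auto)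
  qed
  ultimately show ?thesis
    by (simp add: DERIV_cong_ev)
qed

lemma isCont_F: "norm t < 1 \<Longrightarrow> isCont (F z) t"
  by (rule DERIV_isCont[OF has_field_derivative_F_diffs])

text \<open>Multiplying the derivative by \<open>t\<close> cancels the denominators \<open>n\<close>
  and leaves the negated binomial series of \<open>(1 - t) powr z\<close> without its constant term
  1.\<close>

lemma has_field_derivative_F:
  assumes "norm t < 1" "t \<noteq> 0"
  shows "(F z has_field_derivative (1 - (1 - t) powr z) / t) (at t)"
proof -
  define D where "D = (\<Sum>n. diffs (F_coeff z) n * t ^ n)"
  have "(\<lambda>n. diffs (F_coeff z) n * t ^ n) sums D"
    unfolding D_def
    by (intro summable_sums termdiff_converges[where K = 1] summable_F_coeff) (use assms in auto)
  hence "(\<lambda>n. t * (diffs (F_coeff z) n * t ^ n)) sums (t * D)"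
    by (rule sums_mult)
  also have "(\<lambda>n. t * (diffs (F_coeff z) n * t ^ n)) =
             (\<lambda>n. - ((z gchoose Suc n) * (-1) ^ Suc n * t ^ Suc n))"
    by (simp add: diffs_def F_coeff_def mult_ac del: of_nat_Suc)
  finally have "(\<lambda>n. - ((z gchoose Suc n) * (-1) ^ Suc n * t ^ Suc n)) sums (t * D)" .
  moreover have "(\<lambda>n. - ((z gchoose Suc n) * (-1) ^ Suc n * t ^ Suc n)) sums (1 - (1 - t) powr z)"
  proof -
    have "(\<lambda>n. - ((z gchoose n) * (-1) ^ n * t ^ n)) sums (- ((1 - t) powr z))"
      by (intro sums_minus sums_binomial_minus assms)
    thus ?thesis
      by (subst sums_Suc_iff) auto
  qed
  ultimately have "t * D = 1 - (1 - t) powr z"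
    by (rule sums_unique2)
  thus ?thesis
    using has_field_derivative_F_diffs[OF assms(1), of z] assms(2)
    by (metis D_def nonzero_mult_div_cancel_left)
qed

text \<open>The binomial coefficients are of order \<open>n powr (- Re z - 1)\<close>, and the
  denominator \<open>n\<close> contributes one more power. The resulting exponent
  \<open>- Re z - 2\<close> is below -1 exactly when \<open>Re z > -1\<close>.\<close>

lemma summable_norm_F_coeff:
  assumes "Re z > -1"
  shows "summable (\<lambda>n. norm (F_coeff z n))"
proof -
  \<comment> \<open>The quotient in the asymptotic formula converges, hence is bounded.\<close>
  obtain C where C: "\<And>n. norm ((z gchoose n) / ((-1)^n / exp ((z+1) * of_real (ln (real n))))) \<le> C"
    by (rule BseqE[OF convergent_imp_Bseq[OF convergentI[OF gbinomial_asymptotic[of z]]]]) blast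
  show ?thesis
  proof (rule summable_comparison_test')
    show "summable (\<lambda>n. C * real n powr (- Re z - 2))"
      using assms by (intro summable_mult) (subst summable_real_powr_iff, auto)
    fix n :: nat assume n: "n \<ge> 1"
    have "norm (z gchoose n) * real n powr (Re z + 1) \<le> C"
      using C[of n] n by (simp add: norm_mult norm_divide norm_power powr_def)
    hence "norm (z gchoose n) * real n powr (Re z + 1) * real n powr (- Re z - 2)
             \<le> C * real n powr (- Re z - 2)"
      by (intro mult_right_mono) auto
    also have "norm (z gchoose n) * real n powr (Re z + 1) * real n powr (- Re z - 2) =
               norm (z gchoose n) * real n powr (-1)"
      by (simp only: mult.assoc powr_add [symmetric]) simp
    also have "\<dots> = norm (F_coeff z n)"
      using n by (simp add: F_coeff_def norm_mult norm_divide norm_power powr_minus field_simps)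
    finally show "norm (norm (F_coeff z n)) \<le> C * real n powr (- Re z - 2)"
      by simp
  qed
qed

section \<open>The limit that fixes the constant of integration\<close>

text \<open>Over a common denominator the difference is
  \<open>(1 - a) / ((n + a) * (n + 1))\<close>, which is of order \<open>1 / n ^ 2\<close>.\<close>

lemma summable_norm_Digamma:
  fixes a :: complex
  shows "summable (\<lambda>n. norm (inverse (of_nat n + a) - inverse (of_nat (Suc n))))"
proof (rule summable_comparison_test_ev)
  show "summable (\<lambda>n. 2 * norm (1 - a) * inverse (real n ^ 2))"
    by (intro summable_mult inverse_power_summable) auto
  \<comment> \<open>From here on the norm of \<open>n + a\<close> is at least \<open>n / 2\<close>,
    which bounds the denominator and keeps it away from 0.\<close>
  have "eventually (\<lambda>n. real n > 2 * norm a) at_top"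
    by real_asymp
  thus "eventually (\<lambda>n. norm (norm (inverse (of_nat n + a) - inverse (of_nat (Suc n))))
                          \<le> 2 * norm (1 - a) * inverse (real n ^ 2)) at_top"
  proof eventually_elim
    case (elim n)
    have "n > 0"
      using elim norm_ge_zero[of a] by (intro Nat.gr0I) auto
    have "norm (of_nat n + a) \<ge> real n - norm a"
      using norm_diff_ineq[of "of_nat n" a] by simp
    hence *: "norm (of_nat n + a) \<ge> real n / 2"
      using elim by linarith
    hence nz: "of_nat n + a \<noteq> 0"
      using \<open>n > 0\<close> by auto
    have "inverse (of_nat n + a) - inverse (of_nat (Suc n)) = (1 - a) / ((of_nat n + a) * of_nat (Suc n))"
      using nz by (simp add: divide_simps del: of_nat_Suc) simp
    also have "norm \<dots> = norm (1 - a) / (norm (of_nat n + a) * real (Suc n))"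
      by (simp add: norm_mult norm_divide del: of_nat_Suc)
    also have "\<dots> \<le> norm (1 - a) / (real n / 2 * real n)"
      using * nz \<open>n > 0\<close> by (intro divide_left_mono mult_mono mult_pos_pos) auto
    also have "\<dots> = 2 * norm (1 - a) * inverse (real n ^ 2)"
      using \<open>n > 0\<close> by (simp add: field_simps power2_eq_square)
    finally show ?case
      by simp
  qed
qed

text \<open>Gives the logarithmic singularity at \<open>t = 1\<close> in closed form; the difference
  between general \<open>a\<close> and \<open>a = 1\<close> stays bounded there.\<close>

lemma Lerch_Phi_1_1:
  assumes "norm t < 1"
  shows "t * Lerch_Phi_1 t 1 = - Ln (1 - t)"
proof -
  have "(\<lambda>n. t * (inverse (of_nat n + 1) * t ^ n)) sums (t * Lerch_Phi_1 t 1)"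
    unfolding Lerch_Phi_1_altdef
    by (intro sums_mult summable_sums summable_inverse_shift_powser assms)
  moreover have "(\<lambda>n. t ^ Suc n / of_nat (Suc n)) sums (- Ln (1 - t))"
  proof -
    have "(\<lambda>n. t ^ n / of_nat n) sums (- Ln (1 - t))"
      using sums_minus[OF Ln_series'[of "-t"]] assms by simp
    thus ?thesis
      by (subst sums_Suc_iff) auto
  qed
  moreover have "(\<lambda>n. t * (inverse (of_nat n + 1) * t ^ n)) = (\<lambda>n. t ^ Suc n / of_nat (Suc n))"
    by (simp add: field_simps)
  ultimately show ?thesis
    by (simp add: sums_unique2)
qed

lemma filterlim_of_real_at_left:
  "filterlim (\<lambda>x. of_real x :: complex) (at (of_real c)) (at_left c)"
  by (auto simp: filterlim_at eventually_at_filter intro!: tendsto_intros)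

lemma eventually_in_0_1: "eventually (\<lambda>y. y \<in> {0<..<1}) (at_left (1::real))"
  by (rule eventually_at_left_real) auto

text \<open>Split \<Phi>(y, 1, a) into \<Phi>(y, 1, 1), which carries the singularity, and a power
  series \<open>E\<close> with absolutely summable coefficients, whose value at 1 is a Digamma
  value.\<close>

lemma powr_Lerch_Phi_1_tendsto:
  assumes a: "a \<notin> \<int>\<^sub>\<le>\<^sub>0"
  shows "((\<lambda>y. of_real y powr a * Lerch_Phi_1 (of_real y) a + of_real (ln (1 - y)))
           \<longlongrightarrow> - (Digamma a + euler_mascheroni)) (at_left (1::real))"
proof -
  define e where "e n = inverse (of_nat n + a) - inverse (of_nat (Suc n))" for n
  define E where "E y = (\<Sum>n. e n * of_real y ^ n)" for y :: real
  have "a \<noteq> 0"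
    using a by auto
  \<comment> \<open>The \<open>e n\<close> are the negated terms of the series that defines
    \<open>Digamma\<close>.\<close>
  have sum_e: "(\<Sum>n. e n) = - (Digamma a + euler_mascheroni)"
    unfolding Digamma_def e_def using suminf_minus[OF summable_Digamma[OF \<open>a \<noteq> 0\<close>]]
    by (simp add: add_ac)
  have "(E \<longlongrightarrow> - (Digamma a + euler_mascheroni)) (at_left 1)"
    unfolding E_def sum_e[symmetric]
    using summable_norm_Digamma[of a] by (intro powser_tendsto_at_left_1) (simp add: e_def)
  moreover have pw: "((\<lambda>y. of_real y powr a) \<longlongrightarrow> 1) (at_left (1::real))"
  proof -
    have "isCont (\<lambda>y. y powr a) (1::complex)"
      by (intro continuous_intros) auto
    hence "((\<lambda>y. y powr a) \<longlongrightarrow> 1) (at (1::complex))"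
      by (simp add: isCont_def)
    from filterlim_compose[OF this] show ?thesis
      using filterlim_of_real_at_left[of 1] by simp
  qed
  ultimately have 1: "((\<lambda>y. of_real y powr a * E y) \<longlongrightarrow> 1 * - (Digamma a + euler_mascheroni))
                        (at_left (1::real))"
    by (intro tendsto_mult)
  \<comment> \<open>what is left of \<open>\<Phi>(y, 1, 1) = - log (1 - y) / y\<close> is \<open>log (1 - y) (1 - y^(a - 1))\<close>\<close>
  have 2: "((\<lambda>y. of_real ((1 - y) * ln (1 - y)) * ((of_real y powr (a - 1) - 1) / (of_real y - 1)))
             \<longlongrightarrow> of_real 0 * (a - 1)) (at_left (1::real))"
  proof (intro tendsto_mult tendsto_of_real)
    \<comment> \<open>Inserting the factor \<open>1 - y\<close> tames the logarithm; the
      compensating quotient is the difference quotient of \<open>y powr (a - 1)\<close> at 1, which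
      tends to the derivative \<open>a - 1\<close>.\<close>
    show "((\<lambda>y::real. (1 - y) * ln (1 - y)) \<longlongrightarrow> 0) (at_left 1)"
      by real_asymp
    have "((\<lambda>y. y powr (a - 1)) has_field_derivative (a - 1) * 1 powr (a - 1 - 1)) (at (1::complex))"
      by (rule has_field_derivative_powr) auto
    hence "((\<lambda>y. (y powr (a - 1) - 1) / (y - 1)) \<longlongrightarrow> a - 1) (at (1::complex))"
      by (simp add: has_field_derivative_iff)
    from filterlim_compose[OF this]
    show "((\<lambda>y. (of_real y powr (a - 1) - 1) / (of_real y - 1)) \<longlongrightarrow> a - 1) (at_left (1::real))"
      using filterlim_of_real_at_left[of 1] by simp
  qed
  from eventually_in_0_1 have ev: "eventually (\<lambda>y. of_real y powr a * E y +
                of_real ((1 - y) * ln (1 - y)) * ((of_real y powr (a - 1) - 1) / (of_real y - 1)) =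
              of_real y powr a * Lerch_Phi_1 (of_real y) a + of_real (ln (1 - y))) (at_left 1)"
  proof eventually_elim
    case (elim y)
    have E: "Lerch_Phi_1 (of_real y) a - Lerch_Phi_1 (of_real y) 1 = E y"
    proof -
      have "summable (\<lambda>n. inverse (of_nat n + b) * complex_of_real y ^ n)" for b
        using elim by (intro summable_inverse_shift_powser) auto
      from suminf_diff[OF this this] show ?thesis
        unfolding Lerch_Phi_1_altdef E_def e_def
        by (simp add: left_diff_distrib add.commute)
    qed
    have L: "of_real y * Lerch_Phi_1 (of_real y) 1 = - of_real (ln (1 - y))"
      using Lerch_Phi_1_1[of "of_real y"] elim
      by (simp add: Ln_of_real[symmetric] del: Ln_of_real)
    have pw: "complex_of_real y powr a = of_real y powr (a - 1) * of_real y"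
      using elim by (simp add: powr_diff)
    have l: "of_real ((1 - y) * ln (1 - y)) * ((of_real y powr (a - 1) - 1) / (of_real y - 1)) =
                   of_real (ln (1 - y)) * (1 - of_real y powr (a - 1))"
    proof -
      have "complex_of_real y - 1 \<noteq> 0"
        using elim by (auto simp: complex_eq_iff)
      thus ?thesis
        by (simp add: divide_simps) (simp add: algebra_simps)
    qed
    have "of_real y powr a * E y = of_real y powr a * Lerch_Phi_1 (of_real y) a -
            of_real y powr (a - 1) * (of_real y * Lerch_Phi_1 (of_real y) 1)"
      by (simp add: E[symmetric] pw right_diff_distrib mult.assoc)
    thus ?case
      unfolding l L by (simp add: algebra_simps)
  qed
  show ?thesis
    using Lim_transform_eventually[OF tendsto_add[OF 1 2] ev] by simp
qed

section \<open>The first formula, for positive \<open>x\<close>\<close>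

lemma F_eq_Lerch_Phi_1_of_less_1:
  assumes z: "z + 1 \<notin> \<int>\<^sub>\<le>\<^sub>0" and x: "0 < x" "x < 1"
  shows "F z (of_real x) = Digamma (z + 1) + euler_mascheroni + of_real (ln x) +
           of_real (1 - x) powr (z + 1) * Lerch_Phi_1 (of_real (1 - x)) (z + 1)"
proof -
  define G where "G t = F z t - Ln t - (1 - t) powr (z + 1) * Lerch_Phi_1 (1 - t) (z + 1)" for t
  \<comment> \<open>On this lens both the series in \<open>t\<close> and the one in
    \<open>1 - t\<close> converge. There \<open>t\<close> and \<open>1 - t\<close> have positive
    real part, so the branch cuts are avoided, and convexity gives connectedness.\<close>
  define S where "S = ball (0::complex) 1 \<inter> ball 1 1"
  have "G constant_on S"
  proof (rule has_field_derivative_0_imp_constant_on)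
    show "connected S" "open S"
      by (auto simp: S_def intro!: convex_connected convex_Int)
    fix t assume "t \<in> S"
    hence t: "norm t < 1" "norm (1 - t) < 1"
      by (auto simp: S_def dist_norm)
    have "Re t > 0" "Re (1 - t) > 0"
      using t abs_Re_le_cmod[of "1 - t"] abs_Re_le_cmod[of t] by auto
    hence nz: "t \<notin> \<real>\<^sub>\<le>\<^sub>0" "1 - t \<notin> \<real>\<^sub>\<le>\<^sub>0" "t \<noteq> 0"
      by (auto simp: complex_nonpos_Reals_iff)
    have "((\<lambda>t. (1 - t) powr (z + 1) * Lerch_Phi_1 (1 - t) (z + 1)) has_field_derivative
            (1 - t) powr (z + 1 - 1) / (1 - (1 - t)) * (0 - 1)) (at t)"
      by (rule DERIV_chain2[where g = "\<lambda>t. 1 - t",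
            OF has_field_derivative_powr_Lerch_Phi_1[OF t(2) nz(2) z]])
         (intro derivative_intros)
    hence "(G has_field_derivative ((1 - (1 - t) powr z) / t - 1 / t -
             (1 - t) powr (z + 1 - 1) / (1 - (1 - t)) * (0 - 1))) (at t)"
      unfolding G_def using nz
      by (intro DERIV_diff has_field_derivative_F t)
         (auto intro!: derivative_eq_intros simp: field_simps)
    thus "(G has_field_derivative 0) (at t)"
      by (simp add: diff_divide_distrib)
  qed
  then obtain c where c: "\<And>t. t \<in> S \<Longrightarrow> G t = c"
    by (auto simp: constant_on_def)
  have S_real: "of_real y \<in> S" if "0 < y" "y < 1" for y
  proof -
    have "dist 1 (complex_of_real y) = \<bar>1 - y\<bar>"
      unfolding dist_norm by (metis norm_of_real of_real_1 of_real_diff)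
    thus ?thesis
      using that by (auto simp: S_def)
  qed
  \<comment> \<open>With \<open>y = 1 - t\<close>, this is the limit of \<open>G t\<close> as
    \<open>t\<close> tends to 0 from the right, where \<open>F\<close> tends to
    \<open>F z 0 = 0\<close>.\<close>
  have "((\<lambda>y. F z (of_real (1 - y)) - (of_real y powr (z + 1) * Lerch_Phi_1 (of_real y) (z + 1) + of_real (ln (1 - y))))
          \<longlongrightarrow> 0 - (- (Digamma (z + 1) + euler_mascheroni))) (at_left 1)"
  proof (intro tendsto_diff powr_Lerch_Phi_1_tendsto z)
    have "((\<lambda>y. complex_of_real (1 - y)) \<longlongrightarrow> of_real (1 - 1)) (at_left 1)"
      by (intro tendsto_intros)
    from isCont_tendsto_compose[OF isCont_F this]
    show "((\<lambda>y. F z (of_real (1 - y))) \<longlongrightarrow> 0) (at_left 1)"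
      by simp
  qed
  moreover from eventually_in_0_1 have "eventually (\<lambda>y. F z (of_real (1 - y)) -
           (of_real y powr (z + 1) * Lerch_Phi_1 (of_real y) (z + 1) + of_real (ln (1 - y))) = c) (at_left 1)"
  proof eventually_elim
    case (elim y)
    have "Ln (1 - complex_of_real y) = of_real (ln (1 - y))"
      using elim Ln_of_real[of "1 - y"] by simp
    thus ?case
      using c[OF S_real[of "1 - y"]] elim by (simp add: G_def algebra_simps)
  qed
  ultimately have "((\<lambda>_. c) \<longlongrightarrow> 0 - (- (Digamma (z + 1) + euler_mascheroni))) (at_left (1::real))"
    by (rule Lim_transform_eventually)
  hence "c = Digamma (z + 1) + euler_mascheroni"
    by (simp add: tendsto_const_iff)
  thus ?thesis
    using c[OF S_real[OF x]] x by (simp add: G_def Ln_of_real algebra_simps)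
qed

text \<open>For \<open>Re z \<le> -1\<close> this is the definition of \<open>F\<close>. Otherwise
  both sides of the formula for \<open>x < 1\<close> have limits as \<open>x\<close> tends to 1, and
  \<open>Re z > -1\<close> makes the Lerch term vanish.\<close>

lemma F_1:
  assumes z: "z + 1 \<notin> \<int>\<^sub>\<le>\<^sub>0"
  shows "F z 1 = Digamma (z + 1) + euler_mascheroni"
proof (cases "Re z \<le> -1")
  case True
  thus ?thesis
    by (simp add: F_def)
next
  case False
  hence Re: "Re z > -1"
    by simp
  have lim: "((\<lambda>x. F z (of_real x)) \<longlongrightarrow> F z 1) (at_left 1)"
  proof (rule Lim_transform_eventually)
    have "F z 1 = (\<Sum>n. F_coeff z n)"
      using F_eq_powser[of z 1] summable_norm_cancel[OF summable_norm_F_coeff[OF Re]] Re by simp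
    thus "((\<lambda>x. \<Sum>n. F_coeff z n * of_real x ^ n) \<longlongrightarrow> F z 1) (at_left (1::real))"
      using powser_tendsto_at_left_1[OF summable_norm_F_coeff[OF Re]] by simp
    from eventually_in_0_1 show "eventually (\<lambda>x. (\<Sum>n. F_coeff z n * of_real x ^ n) = F z (of_real x)) (at_left (1::real))"
      by eventually_elim (auto intro!: F_eq_powser[symmetric] summable_F_coeff)
  qed
  have y: "((\<lambda>x::real. 1 - x) \<longlongrightarrow> 0) (at_left 1)"
    by real_asymp
  have "((\<lambda>x. Digamma (z + 1) + euler_mascheroni + of_real (ln x) +
           of_real (1 - x) powr (z + 1) * Lerch_Phi_1 (of_real (1 - x)) (z + 1))
          \<longlongrightarrow> Digamma (z + 1) + euler_mascheroni + of_real 0 + 0 * Lerch_Phi_1 (of_real 0) (z + 1))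
          (at_left (1::real))"
  proof (intro tendsto_add tendsto_const tendsto_of_real tendsto_mult)
    show "(ln \<longlongrightarrow> 0) (at_left (1::real))"
      by real_asymp
    \<comment> \<open>The modulus of the complex power is a real power with positive
      exponent.\<close>
    have "((\<lambda>x. (1 - x) powr (Re z + 1)) \<longlongrightarrow> 0) (at_left (1::real))"
      using Re by real_asymp
    moreover from eventually_in_0_1 have "eventually (\<lambda>x. (1 - x) powr (Re z + 1) = norm (of_real (1 - x) powr (z + 1))) (at_left (1::real))"
      by eventually_elim (simp add: norm_powr_real_powr del: of_real_diff)
    ultimately have "((\<lambda>x. norm (complex_of_real (1 - x) powr (z + 1))) \<longlongrightarrow> 0) (at_left (1::real))"
      by (rule Lim_transform_eventually)
    thus "((\<lambda>x. complex_of_real (1 - x) powr (z + 1)) \<longlongrightarrow> 0) (at_left (1::real))"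
      by (rule tendsto_norm_zero_cancel)
    show "((\<lambda>x. Lerch_Phi_1 (of_real (1 - x)) (z + 1)) \<longlongrightarrow> Lerch_Phi_1 (of_real 0) (z + 1)) (at_left (1::real))"
      by (rule isCont_tendsto_compose[OF isCont_Lerch_Phi_1 tendsto_of_real[OF y]]) auto
  qed
  moreover from eventually_in_0_1 have "eventually (\<lambda>x. Digamma (z + 1) + euler_mascheroni + of_real (ln x) +
           of_real (1 - x) powr (z + 1) * Lerch_Phi_1 (of_real (1 - x)) (z + 1) = F z (of_real x)) (at_left (1::real))"
    by eventually_elim (use F_eq_Lerch_Phi_1_of_less_1[OF z] in auto)
  ultimately have "((\<lambda>x. F z (of_real x)) \<longlongrightarrow> Digamma (z + 1) + euler_mascheroni + of_real 0 +
                     0 * Lerch_Phi_1 (of_real 0) (z + 1)) (at_left (1::real))"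
    by (rule Lim_transform_eventually)
  from tendsto_unique[OF _ lim this] show ?thesis
    by simp
qed

lemma F_eq_Lerch_Phi_1:
  assumes "z + 1 \<notin> \<int>\<^sub>\<le>\<^sub>0" "0 < x" "x \<le> 1"
  shows "F z (of_real x) = Digamma (z + 1) + euler_mascheroni + of_real (ln x) +
           of_real (1 - x) powr (z + 1) * Lerch_Phi_1 (of_real (1 - x)) (z + 1)"
  using F_eq_Lerch_Phi_1_of_less_1[OF assms(1,2)] F_1[OF assms(1)] assms by (cases "x = 1") auto

text \<open>For \<open>y \<noteq> 0\<close> the factor \<open>y powr a\<close> is absorbed into each
  term. For \<open>y = 0\<close>, which corresponds to \<open>x = 1\<close>, all powers are 0 by the
  convention for \<open>powr\<close>.\<close>

lemma powr_Lerch_Phi_1_sums: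
  assumes "0 \<le> y" "y < 1"
  shows "(\<lambda>n. of_real y powr (a + of_nat n) / (a + of_nat n)) sums
           (of_real y powr a * Lerch_Phi_1 (of_real y) a)"
proof (cases "y = 0")
  case False
  have "(\<lambda>n. of_real y powr a * (inverse (of_nat n + a) * of_real y ^ n)) sums
           (of_real y powr a * Lerch_Phi_1 (of_real y) a)"
    unfolding Lerch_Phi_1_altdef using assms
    by (intro sums_mult summable_sums summable_inverse_shift_powser) auto
  also have "(\<lambda>n. of_real y powr a * (inverse (of_nat n + a) * of_real y ^ n)) =
             (\<lambda>n. of_real y powr (a + of_nat n) / (a + of_nat n))"
    using False by (simp add: powr_add powr_nat' field_simps)
  finally show ?thesis .
qed auto

section \<open>The Landen-type identity and the second formula, for negative
  \<open>x\<close>\<close>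

text \<open>Both sides vanish at 0 and have the same derivative, because
  \<open>w = t / (t - 1)\<close> satisfies \<open>1 - w = 1 / (1 - t)\<close>.\<close>

lemma F_Landen:
  assumes t: "norm t < 1" "Re t < 1 / 2" and z: "z \<noteq> 0"
  shows "F z t = F (-z) (t / (t - 1)) + Ln (1 - t) + (1 - (1 - t) powr z) / z"
proof -
  define S where "S = ball (0::complex) 1 \<inter> {t. Re t < 1 / 2}"
  define G where "G t = F z t - F (-z) (t / (t - 1)) - Ln (1 - t) - (1 - (1 - t) powr z) / z" for t
  have S: "norm t < 1" "t \<noteq> 1" "1 - t \<notin> \<real>\<^sub>\<le>\<^sub>0" "norm (t / (t - 1)) < 1" if "t \<in> S" for t
  proof -
    show *: "norm t < 1" "t \<noteq> 1" "1 - t \<notin> \<real>\<^sub>\<le>\<^sub>0"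
      using that by (auto simp: S_def complex_nonpos_Reals_iff)
    \<comment> \<open>Expanding the squares reduces this to \<open>2 * Re t < 1\<close>, so the
      half-plane condition is what puts \<open>t / (t - 1)\<close> inside the unit disc.\<close>
    have "norm t ^ 2 < norm (t - 1) ^ 2"
      unfolding cmod_power2 using that by (auto simp: S_def power2_eq_square algebra_simps)
    hence "norm t < norm (t - 1)"
      by (rule power_less_imp_less_base) auto
    thus "norm (t / (t - 1)) < 1"
      using * by (simp add: norm_divide)
  qed
  \<comment> \<open>The derivative formula for \<open>F\<close> divides by \<open>t\<close>, so 0 is
    left out; continuity of \<open>G\<close> bridges this single exceptional point.\<close>
  have deriv: "(G has_field_derivative 0) (at t)" if "t \<in> S - {0}" for t
  proof -
    have t: "t \<in> S" "t \<noteq> 0"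
      using that by auto
    note St = S[OF t(1)]
    have w: "((\<lambda>t. t / (t - 1)) has_field_derivative - 1 / (t - 1) ^ 2) (at t)"
      using St by (auto intro!: derivative_eq_intros simp: power2_eq_square divide_simps)
    have "((\<lambda>t. F (-z) (t / (t - 1))) has_field_derivative
            (1 - (1 - t / (t - 1)) powr (-z)) / (t / (t - 1)) * (- 1 / (t - 1) ^ 2)) (at t)"
      using t St by (intro DERIV_chain2[OF has_field_derivative_F w]) auto
    also have "1 - t / (t - 1) = inverse (1 - t)"
      using St by (simp add: divide_simps)
    \<comment> \<open>Off the cut the principal logarithm changes sign under inversion, which
      cancels the sign of \<open>-z\<close>.\<close>
    also have "inverse (1 - t) powr (-z) = (1 - t) powr z"
      using St by (simp add: powr_def Ln_inverse)
    finally have *: "((\<lambda>t. F (-z) (t / (t - 1))) has_field_derivative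
            (1 - (1 - t) powr z) / (t / (t - 1)) * (- 1 / (t - 1) ^ 2)) (at t)" .
    have "(G has_field_derivative (1 - (1 - t) powr z) / t
             - (1 - (1 - t) powr z) / (t / (t - 1)) * (- 1 / (t - 1) ^ 2)
             - (- 1 / (1 - t)) - (1 - t) powr (z - 1)) (at t)"
      unfolding G_def
      by (intro DERIV_diff has_field_derivative_F *)
         (use St t z in \<open>auto intro!: derivative_eq_intros simp: field_simps\<close>)
    also have "(1 - t) powr (z - 1) = (1 - t) powr z / (1 - t)"
      using St by (simp add: powr_diff)
    also have "(1 - (1 - t) powr z) / t
             - (1 - (1 - t) powr z) / (t / (t - 1)) * (- 1 / (t - 1) ^ 2)
             - (- 1 / (1 - t)) - (1 - t) powr z / (1 - t) = 0"
      using St t by (simp add: divide_simps power2_eq_square) (simp add: algebra_simps)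
    finally show ?thesis .
  qed
  have "open S" "connected S"
    unfolding S_def by (intro open_Int open_halfspace_Re_lt convex_connected convex_Int
      convex_halfspace_Re_lt open_ball convex_ball)+
  moreover have "0 \<in> S"
    by (simp add: S_def)
  moreover have "continuous_on S G"
  proof (intro continuous_at_imp_continuous_on ballI)
    fix t assume "t \<in> S"
    note St = S[OF this]
    have "isCont (\<lambda>t. F (-z) (t / (t - 1))) t"
      using St by (intro isCont_o2[OF _ isCont_F]) (auto intro!: continuous_intros)
    thus "isCont G t"
      unfolding G_def using St z by (intro continuous_intros isCont_F) auto
  qed
  ultimately obtain c where c: "\<And>t. t \<in> S \<Longrightarrow> G t = c"
    using DERIV_zero_connected_constant[of S "{0}" G] deriv by blast
  have "G 0 = 0"
    by (simp add: G_def)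
  hence "G t = 0"
    using c[of 0] c[of t] \<open>0 \<in> S\<close> t by (simp add: S_def)
  thus ?thesis
    by (simp add: G_def algebra_simps)
qed

lemma F_eq_Lerch_Phi_1_neg:
  assumes z: "z \<notin> \<nat>" and x: "-1 < x" "x < 0"
  shows "F z (of_real x) = Digamma (1 - z) + euler_mascheroni + of_real (ln (- x)) +
           (1 - of_real (1 - x) powr z) / z +
           of_real (1 - x) powr (z - 1) * Lerch_Phi_1 (of_real (1 / (1 - x))) (1 - z)"
proof -
  \<comment> \<open>The Landen argument lies in the range of the first formula, and
    \<open>1 - u\<close> is the argument of the Lerch term to be reached.\<close>
  define u where "u = x / (x - 1)"
  have u: "0 < u" "u \<le> 1" "1 - u = inverse (1 - x)"
    using x by (auto simp: u_def field_simps)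
  have z': "-z + 1 \<notin> \<int>\<^sub>\<le>\<^sub>0"
  proof
    assume "-z + 1 \<in> \<int>\<^sub>\<le>\<^sub>0"
    then obtain n where "-z + 1 = - of_nat n"
      by (auto elim!: nonpos_Ints_cases')
    hence "z = of_nat (Suc n)"
      by (simp add: algebra_simps)
    thus False
      using z by (metis of_nat_in_Nats)
  qed
  have "z \<noteq> 0"
    using z by auto
  have "F z (of_real x) = F (-z) (of_real u) + Ln (1 - of_real x) + (1 - of_real (1 - x) powr z) / z"
    using F_Landen[of "of_real x" z] x \<open>z \<noteq> 0\<close> by (simp add: u_def)
  also have "Ln (1 - of_real x) = of_real (ln (1 - x))"
    using x Ln_of_real[of "1 - x"] by simp
  also have "F (-z) (of_real u) = Digamma (-z + 1) + euler_mascheroni + of_real (ln u) +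
           of_real (1 - u) powr (-z + 1) * Lerch_Phi_1 (of_real (1 - u)) (-z + 1)"
    by (rule F_eq_Lerch_Phi_1[OF z' u(1,2)])
  also have "of_real (1 - u) powr (-z + 1) = of_real (1 - x) powr (z - 1)"
    using x by (simp add: u(3) powr_def Ln_of_real ln_inverse Ln_inverse algebra_simps
        del: of_real_diff)
  \<comment> \<open>The term \<open>- ln (1 - x)\<close> cancels the logarithm contributed by
    \<open>F_Landen\<close>.\<close>
  also have "ln u = ln (- x) - ln (1 - x)"
  proof -
    have "u = - x / (1 - x)"
      using x by (simp add: u_def divide_simps algebra_simps)
    thus ?thesis
      using x ln_div[of "-x" "1 - x"] by simp
  qed
  finally show ?thesis
    using u(3) by (simp add: inverse_eq_divide)
qed

section \<open>Both formulas together\<close>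

theorem theorem3:
  fixes z :: complex and x :: real
  shows
    "(z \<notin> {- of_nat k |k::nat. k \<ge> 1} \<and> 0 < x \<and> x \<le> 1 \<longrightarrow>
       summable (\<lambda>n. of_real (1 - x) powr (z + of_nat (Suc n)) / (z + of_nat (Suc n))) \<and>
       F z (of_real x) =
         Digamma (z + 1) + euler_mascheroni + of_real (ln x) +
         (\<Sum>n. of_real (1 - x) powr (z + of_nat (Suc n)) / (z + of_nat (Suc n))) \<and>
       F z (of_real x) =
         Digamma (z + 1) + euler_mascheroni + of_real (ln x) +
         of_real (1 - x) powr (z + 1) * Lerch_Phi_1 (of_real (1 - x)) (z + 1)) \<and>
     (z \<notin> \<nat> \<and> -1 < x \<and> x < 0 \<longrightarrow>
       F z (of_real x) =
         Digamma (1 - z) + euler_mascheroni + of_real (ln (- x)) +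
         (1 - of_real (1 - x) powr z) / z +
         of_real (1 - x) powr (z - 1) * Lerch_Phi_1 (of_real (1 / (1 - x))) (1 - z))"
proof (rule conjI; rule impI; elim conjE)
  assume z: "z \<notin> {- of_nat k |k::nat. k \<ge> 1}" and x: "0 < x" "x \<le> 1"
  have z': "z + 1 \<notin> \<int>\<^sub>\<le>\<^sub>0"
  proof
    assume "z + 1 \<in> \<int>\<^sub>\<le>\<^sub>0"
    then obtain n where "z + 1 = - of_nat n"
      by (auto elim!: nonpos_Ints_cases')
    hence "z = - of_nat (Suc n)"
      by (simp add: eq_diff_eq[symmetric])
    thus False
      using z by (auto simp del: of_nat_Suc)
  qed
  \<comment> \<open>The sum over \<open>n \<ge> 1\<close> with shift \<open>z\<close> is the sum
    over \<open>n \<ge> 0\<close> with shift \<open>z + 1\<close>.\<close>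
  have "(\<lambda>n. of_real (1 - x) powr (z + of_nat (Suc n)) / (z + of_nat (Suc n))) sums
          (of_real (1 - x) powr (z + 1) * Lerch_Phi_1 (of_real (1 - x)) (z + 1))"
    using powr_Lerch_Phi_1_sums[of "1 - x" "z + 1"] x by (simp add: add.assoc)
  thus "summable (\<lambda>n. of_real (1 - x) powr (z + of_nat (Suc n)) / (z + of_nat (Suc n))) \<and>
       F z (of_real x) =
         Digamma (z + 1) + euler_mascheroni + of_real (ln x) +
         (\<Sum>n. of_real (1 - x) powr (z + of_nat (Suc n)) / (z + of_nat (Suc n))) \<and>
       F z (of_real x) =
         Digamma (z + 1) + euler_mascheroni + of_real (ln x) +
         of_real (1 - x) powr (z + 1) * Lerch_Phi_1 (of_real (1 - x)) (z + 1)"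
    using F_eq_Lerch_Phi_1[OF z' x] by (simp only: sums_iff)
next
  assume "z \<notin> \<nat>" "-1 < x" "x < 0"
  thus "F z (of_real x) =
         Digamma (1 - z) + euler_mascheroni + of_real (ln (- x)) +
         (1 - of_real (1 - x) powr z) / z +
         of_real (1 - x) powr (z - 1) * Lerch_Phi_1 (of_real (1 / (1 - x))) (1 - z)"
    by (rule F_eq_Lerch_Phi_1_neg)
qed

end
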